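(* Let $\theta=p/q\in(0,1]$, where $p,q\in\mathbb{N}$, $q$ is odd, and $\Upsilon(p,q)=2$. Let $\mathcal{G}(\theta)=(a_n)_{n=1}^\infty$. Then $$a_1=\frac{q+2}{p},\qquad a_2=\left\lfloor\frac{qa_1}{2}\right\rfloor+1,$$ and $$\frac{p}{q}-\sum_{i=1}^{n-1}\frac{1}{a_i}=\frac{1}{q\prod_{i=1}^{n-1}a_i},\quad n\geqslant 3.$$ Hence, $$a_n=q\prod_{i=1}^{n-1}a_i+1,\quad n\geqslant 3.$$
   Context: $\mathbb{N}$ is the set of positive integers. For $p,q\in\mathbb{N}$, $\Upsilon(p,q)$ is the smallest positive integer $m$ such that $p$ divides $q+m$. For $\theta\in(0,1]$ let $G(\theta)=\lfloor 1/\theta\rfloor+1$. The greedy algorithm $\mathcal{G}$ produces the sequence $\mathcal{G}(\theta)=(a_n)_{n=1}^\infty$ of positive integers defined by $a_1=G(\theta)$ and $a_m=G\left(\theta-\sum_{n=1}^{m-1}1/a_n\right)$ for $m\geqslant 2$. *)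

theory Defs
  imports Complex_Main
begin

definition Upsilon :: "nat \<Rightarrow> nat \<Rightarrow> nat" where
  "Upsilon p q = (LEAST m. 0 < m \<and> p dvd q + m)"

(* On the intended domain 0 < \<theta> \<le> 1 the floor is positive, so nat loses nothing. *)
definition G :: "real \<Rightarrow> nat" where
  "G \<theta> = nat \<lfloor>1 / \<theta>\<rfloor> + 1"

(* Sequences are indexed from 1; the value at index 0 is junk (it repeats a_1).
   At m = 1 the sum is empty, so the single equation covers both clauses of the recursion. *)
function greedy :: "real \<Rightarrow> nat \<Rightarrow> nat" where
  "greedy \<theta> m = G (\<theta> - (\<Sum>n\<in>{1..m - 1}. 1 / real (greedy \<theta> n)))"
  by auto
termination
  by (relation "measure snd") auto

declare greedy.simps [simp del]

lemma greedy_1: "greedy \<theta> 1 = G \<theta>"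
  by (subst greedy.simps) simp

end

theory Submission
  imports Defs
begin

text \<open>With $p a_1 = q + 2$ the first remainder is $2/(q a_1)$, where $q a_1$ is odd; so
  $2 a_2 = q a_1 + 1$ and the second remainder is the unit fraction $1/(q a_1 a_2)$. From then on the
  identity $1/N - 1/(N+1) = 1/(N(N+1))$ keeps every remainder a unit fraction.\<close>

text \<open>The \<open>LEAST\<close> is attained once one candidate exists:
  \<open>m = (p - 1) * q + p\<close> is positive and makes \<open>q + m\<close> equal to
  \<open>p * (q + 1)\<close>.\<close>

lemma dvd_add_Upsilon:
  assumes "0 < p"
  shows "p dvd q + Upsilon p q"
proof -
  have "q + ((p - 1) * q + p) = p * (q + 1)"
    using assms by (cases p) simp_all
  then have "0 < (p - 1) * q + p \<and> p dvd q + ((p - 1) * q + p)"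
    using assms by (metis add_gr_0 dvd_triv_left)
  then have "0 < Upsilon p q \<and> p dvd q + Upsilon p q"
    unfolding Upsilon_def by (rule LeastI)
  then show ?thesis ..
qed

lemma Upsilon_le: "0 < m \<Longrightarrow> p dvd q + m \<Longrightarrow> Upsilon p q \<le> m"
  unfolding Upsilon_def by (rule Least_le) simp

text \<open>Moves the floor into natural-number division; it is applied with numerator
  \<open>p\<close> for the first term, 2 for the second and 1 for all later ones.\<close>

lemma G_divide: "G (real p / real q) = q div p + 1"
  by (simp add: G_def floor_divide_of_nat_eq)

lemma greedy_Suc:
  "greedy \<theta> (Suc n) = G (\<theta> - (\<Sum>i\<in>{1..n}. 1 / real (greedy \<theta> i)))"
  by (subst greedy.simps) simp

lemma greedy_eq_if_unit_remainder:
  assumes "\<theta> - (\<Sum>i\<in>{1..n}. 1 / real (greedy \<theta> i)) = 1 / real N"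
  shows "greedy \<theta> (Suc n) = N + 1"
  using assms G_divide[of 1 N] by (simp add: greedy_Suc)

text \<open>Reduces the claim for all later terms to a single check at \<open>k\<close>. The
  denominator \<open>N\<close> forces the next term \<open>N + 1\<close>, so the new denominator
  \<open>N * (N + 1)\<close> is again \<open>q\<close> times the product of the terms.\<close>

lemma greedy_unit_remainder_persists:
  assumes "k \<le> n" and "0 < q"
    and "\<theta> - (\<Sum>i\<in>{1..k}. 1 / real (greedy \<theta> i))
      = 1 / real (q * (\<Prod>i\<in>{1..k}. greedy \<theta> i))"
  shows "\<theta> - (\<Sum>i\<in>{1..n}. 1 / real (greedy \<theta> i))
      = 1 / real (q * (\<Prod>i\<in>{1..n}. greedy \<theta> i))"
  using assms(1)
proof (induction n rule: dec_induct)
  case base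
  show ?case by (fact assms(3))
next
  case (step n)
  define N where "N = q * (\<Prod>i\<in>{1..n}. greedy \<theta> i)"
  have a: "greedy \<theta> (Suc n) = N + 1"
    using greedy_eq_if_unit_remainder[OF step.IH] by (simp add: N_def)
  \<comment> \<open>\<open>G\<close> adds 1 to a natural number, so it is positive at every
    argument.\<close>
  have "greedy \<theta> i > 0" for i
    by (subst greedy.simps) (simp add: G_def)
  then have "N > 0"
    using assms(2) by (simp add: N_def prod_pos)
  have "\<theta> - (\<Sum>i\<in>{1..Suc n}. 1 / real (greedy \<theta> i)) = 1 / real N - 1 / real (N + 1)"
    using step.IH by (simp add: a N_def)
  also have "\<dots> = 1 / real (N * (N + 1))"
    using \<open>N > 0\<close> by (simp add: field_simps)
  also have "N * (N + 1) = q * (\<Prod>i\<in>{1..Suc n}. greedy \<theta> i)"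
    by (simp add: a N_def algebra_simps)
  finally show ?case .
qed

theorem proposition1p10:
  fixes p q :: nat and \<theta> :: real and a :: "nat \<Rightarrow> nat"
  assumes "0 < p" and "0 < q"
    and "\<theta> = real p / real q"
    and "0 < \<theta>" and "\<theta> \<le> 1"
    and "odd q"
    and "Upsilon p q = 2"
    and "a = greedy \<theta>"
  shows "real (a 1) = (real q + 2) / real p
    \<and> int (a 2) = \<lfloor>real q * real (a 1) / 2\<rfloor> + 1
    \<and> (\<forall>n\<ge>3. real p / real q - (\<Sum>i\<in>{1..n - 1}. 1 / real (a i))
          = 1 / (real q * (\<Prod>i\<in>{1..n - 1}. real (a i))))
    \<and> (\<forall>n\<ge>3. a n = q * (\<Prod>i\<in>{1..n - 1}. a i) + 1)"
proof -
  have dvd: "p dvd q + 2"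
    using dvd_add_Upsilon[OF assms(1), of q] assms(7) by simp
  \<comment> \<open>1 divides \<open>q + 1\<close>, so \<open>p = 1\<close> would give
    \<open>Upsilon p q \<le> 1\<close>.\<close>
  have "p \<noteq> 1"
    using Upsilon_le[of 1 p q] assms(7) by auto
  moreover have "odd p"
    using dvd \<open>odd q\<close> by (metis dvd_trans even_add even_numeral)
  ultimately have p: "p \<ge> 3"
    using \<open>0 < p\<close> by (cases "p = 2") auto
  obtain A where A: "q + 2 = p * A"
    using dvd by (auto simp: dvd_def)
  have "odd A"
    using A \<open>odd q\<close> by (metis even_add even_mult_iff even_numeral)
  have "A > 0"
    using \<open>odd A\<close> by (rule odd_pos)
  \<comment> \<open>Division with remainder of \<open>q = p * A - 2\<close> by \<open>p\<close>: the
    remainder is \<open>p - 2\<close>, where \<open>p \<ge> 3\<close> keeps the subtraction from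
    truncating, so the quotient is \<open>A - 1\<close>.\<close>
  have "q = (p - 2) + p * (A - 1)"
    using A p \<open>A > 0\<close> by (cases A) auto
  then have "q div p = (p - 2) div p + (A - 1)"
    using div_mult_self2[of p "p - 2" "A - 1"] \<open>0 < p\<close> by simp
  then have "q div p + 1 = A"
    using p \<open>A > 0\<close> by simp
  then have a1: "greedy \<theta> 1 = A"
    using greedy_1[of \<theta>] by (simp add: assms(3) G_divide)
  have "real q + 2 = real p * real A"
    using arg_cong[OF A, of real] by simp
  then have a1_eq: "real A = (real q + 2) / real p"
    and rem1: "\<theta> - 1 / real A = 2 / real (q * A)"
    unfolding assms(3) using assms(1,2) \<open>A > 0\<close> by (simp_all add: field_simps)
  define B where "B = q * A div 2 + 1"
  have a2: "greedy \<theta> 2 = B"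
  proof -
    have "greedy \<theta> (Suc 1) = G (real 2 / real (q * A))"
      using rem1 a1 by (subst greedy_Suc) simp
    then show ?thesis
      by (simp only: G_divide B_def Suc_1)
  qed
  have a2_eq: "int B = \<lfloor>real q * real A / 2\<rfloor> + 1"
    using floor_divide_of_nat_eq[of "q * A" 2, where ?'a = real] by (simp add: B_def)
  \<comment> \<open>As \<open>q * A\<close> is odd, halving it loses exactly 1/2. This makes the
    numerator \<open>2 * B - q * A\<close> of the second remainder equal to 1.\<close>
  have "2 * B = q * A + 1"
    using \<open>odd q\<close> \<open>odd A\<close> by (simp add: B_def odd_two_times_div_two_succ)
  then have B: "2 * real B = real (q * A) + 1"
    by (metis of_nat_1 of_nat_add of_nat_mult of_nat_numeral)
  have "2 / real (q * A) - 1 / real B = 1 / real (q * A * B)"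
  proof -
    have "B > 0"
      by (simp add: B_def)
    show ?thesis
      using B \<open>0 < q\<close> \<open>A > 0\<close> \<open>B > 0\<close> by (simp add: divide_simps)
  qed
  then have "\<theta> - (\<Sum>i\<in>{1..2}. 1 / real (greedy \<theta> i))
      = 1 / real (q * (\<Prod>i\<in>{1..2}. greedy \<theta> i))"
    using rem1 a1 a2 by (simp add: numeral_2_eq_2 mult.assoc)
  \<comment> \<open>The remainder that determines term \<open>n\<close> involves the first
    \<open>n - 1\<close> terms, so the base case \<open>k = 2\<close> corresponds to
    \<open>n = 3\<close>.\<close>
  then have rem: "\<theta> - (\<Sum>i\<in>{1..n - 1}. 1 / real (greedy \<theta> i))
      = 1 / real (q * (\<Prod>i\<in>{1..n - 1}. greedy \<theta> i))" if "n \<ge> 3" for n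
    using greedy_unit_remainder_persists[of 2 "n - 1" q \<theta>] \<open>0 < q\<close> that by linarith
  have "greedy \<theta> n = q * (\<Prod>i\<in>{1..n - 1}. greedy \<theta> i) + 1" if "n \<ge> 3" for n
    using greedy_eq_if_unit_remainder[OF rem[OF that]] that by simp
  then show ?thesis
    using a1 a1_eq a2 a2_eq rem unfolding assms(8) assms(3)[symmetric] by simp
qed

end
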